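(* Let $G=\{g_1:=0,g_2,\ldots,g_n\}$ be a finite Abelian group of odd order $n\ge 5$, and let $$L_G=\Big\{{\boldsymbol x}=(x_1,\ldots,x_n)\in\mathbb{Z}^n:\ \sum_{i=1}^n x_i=0,\ \sum_{j=2}^n x_j g_j=0\Big\}.$$ Then $L_G$ is strongly eutactic.
   Context: For a lattice $\Lambda$ let $|\Lambda|$ be its minimal nonzero Euclidean norm and $S(\Lambda)$ its set of vectors of norm $|\Lambda|$. $\Lambda$ is strongly eutactic (in $V=\operatorname{span}_{\mathbb R}\Lambda$) if $\frac{1}{|\Lambda|}S(\Lambda)$ is a spherical $2$-design in $V$, i.e. the average over the unit sphere of $V$ of every real polynomial of degree $\le 2$ equals its average over this finite set; equivalently, $\sum_{{\boldsymbol x}\in S(\Lambda)}({\boldsymbol x},{\boldsymbol y})^2=\frac{|\Lambda|^2|S(\Lambda)|}{\dim V}({\boldsymbol y},{\boldsymbol y})$ for all ${\boldsymbol y}\in V$. *)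

theory Defs
  imports "HOL-Analysis.Analysis" "HOL-Algebra.FiniteProduct"
begin

definition euclidean_lattice :: "'a::euclidean_space set \<Rightarrow> bool" where
  "euclidean_lattice \<Lambda> \<longleftrightarrow>
     0 \<in> \<Lambda> \<and> (\<forall>x\<in>\<Lambda>. \<forall>y\<in>\<Lambda>. x - y \<in> \<Lambda>) \<and> discrete \<Lambda>"

(* For a nonzero lattice the infimum is attained, i.e. it is a minimum. *)
definition min_norm :: "'a::euclidean_space set \<Rightarrow> real" where
  "min_norm \<Lambda> = Inf (norm ` (\<Lambda> - {0}))"

definition min_vectors :: "'a::euclidean_space set \<Rightarrow> 'a set" where
  "min_vectors \<Lambda> = {x \<in> \<Lambda>. norm x = min_norm \<Lambda>}"

(* Polynomial functions of total degree at most t; e b is the exponent of the coordinate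
   x \<bullet> b.  Exponents are fixed to be 0 outside Basis so that the sum is finite.
   Polynomial functions on a subspace V are the restrictions of these to V. *)
definition poly_degree_le :: "nat \<Rightarrow> ('a::euclidean_space \<Rightarrow> real) \<Rightarrow> bool" where
  "poly_degree_le t f \<longleftrightarrow>
     (\<exists>c. \<forall>x. f x =
        (\<Sum>e | (\<forall>b. b \<notin> Basis \<longrightarrow> e b = 0) \<and> (\<Sum>b\<in>Basis. e b) \<le> t.
           c e * (\<Prod>b\<in>Basis. (x \<bullet> b) ^ e b)))"

definition orthonormal_basis_of :: "'a::euclidean_space set \<Rightarrow> 'a set \<Rightarrow> bool" where
  "orthonormal_basis_of V B \<longleftrightarrow>
     B \<subseteq> V \<and> pairwise orthogonal B \<and> (\<forall>b\<in>B. norm b = 1) \<and> span B = V"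

(* Lebesgue measure of the subspace V, as a Borel measure on the ambient space supported
   on V (compare lborel_def).  It does not depend on the orthonormal basis chosen. *)
definition subspace_lborel :: "'a::euclidean_space set \<Rightarrow> 'a measure" where
  "subspace_lborel V =
     (let B = (SOME B. orthonormal_basis_of V B)
      in distr (\<Pi>\<^sub>M b\<in>B. (lborel :: real measure)) borel (\<lambda>c. \<Sum>b\<in>B. c b *\<^sub>R b))"

(* Average with respect to the rotation-invariant probability measure on the unit sphere
   of V, which is the image of the uniform distribution on the unit ball of V under
   x \<mapsto> x / norm x (for dim V > 0 the origin is a null set). *)
definition sphere_average :: "'a::euclidean_space set \<Rightarrow> ('a \<Rightarrow> real) \<Rightarrow> real" where
  "sphere_average V f =
     (LINT x : cball 0 1 | subspace_lborel V. f (x /\<^sub>R norm x))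
       / measure (subspace_lborel V) (cball 0 1)"

definition spherical_design :: "nat \<Rightarrow> 'a::euclidean_space set \<Rightarrow> 'a set \<Rightarrow> bool" where
  "spherical_design t V X \<longleftrightarrow>
     finite X \<and> X \<noteq> {} \<and> X \<subseteq> V \<inter> sphere 0 1 \<and>
     (\<forall>f. poly_degree_le t f \<longrightarrow> sphere_average V f = (\<Sum>x\<in>X. f x) / real (card X))"

definition strongly_eutactic :: "'a::euclidean_space set \<Rightarrow> bool" where
  "strongly_eutactic \<Lambda> \<longleftrightarrow>
     euclidean_lattice \<Lambda> \<and>
     spherical_design 2 (span \<Lambda>) ((\<lambda>x. x /\<^sub>R min_norm \<Lambda>) ` min_vectors \<Lambda>)"

(* The index type 'n plays the role of {1..n}, g enumerates the elements of G and i0 is the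
   index of the neutral element.  The abelian group G is written multiplicatively, so that
   the condition \<Sum> x_j g_j = 0 becomes \<Prod> g_j ^ x_j = 1. *)
definition group_lattice ::
    "('a, 'b) monoid_scheme \<Rightarrow> ('n::finite \<Rightarrow> 'a) \<Rightarrow> 'n \<Rightarrow> (real ^ 'n) set" where
  "group_lattice G g i0 =
     {\<chi> i. real_of_int (z i) | z :: 'n \<Rightarrow> int.
        (\<Sum>i\<in>UNIV. z i) = 0 \<and>
        (\<Otimes>\<^bsub>G\<^esub>j\<in>UNIV - {i0}. g j [^]\<^bsub>G\<^esub> z j) = \<one>\<^bsub>G\<^esub>}"

end

theory Submission
  imports Defs "HOL-Algebra.Multiplicative_Group"
begin

text \<open>
  By the moments of the unit ball of a subspace, a finite subset of the unit sphere with vanishing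
  sum that satisfies the eutaxy identity is a spherical 2-design.  For \<open>L_G\<close>, the minimal norm is 2
  and the minimal vectors are \<open>e_a + e_b - e_c - e_d\<close> with distinct indices and
  \<open>g_a + g_b = g_c + g_d = s\<close>.  For a fixed \<open>s\<close> the involution \<open>g \<mapsto> s - g\<close> has exactly one fixed
  point because the order is odd, and it pairs off the other elements; summing
  \<open>(x \<bullet> y)\<^sup>2\<close> first over the pairs of a given \<open>s\<close> and then over \<open>s\<close> gives a multiple of \<open>y \<bullet> y\<close>
  when the coordinates of \<open>y\<close> sum to zero.
\<close>

subsection \<open>A criterion for spherical 2-designs\<close>

text \<open>For fixed \<open>s\<close> put \<open>h a = y_a + y_{s-a}\<close> and let
  \<open>K\<close> be the non-fixed indices. All squared differences over
  \<open>K \<times> K\<close> add up to \<open>2 |K| \<Sum>h^2 - 2 (\<Sum>h)^2\<close>. Because the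
  coordinates of \<open>y\<close> sum to zero, \<open>\<Sum>h\<close> over \<open>K\<close> is minus
  twice the sum of \<open>y\<close> over the fixed points. Odd order enters exactly here: there is a
  single fixed point \<open>m s\<close>, so \<open>|K| = n - 1\<close> for every \<open>s\<close>
  and \<open>(\<Sum>h)^2\<close> is four times the square of one coordinate. As \<open>m\<close> is
  a permutation of the indices, these squares add up to a multiple of \<open>y \<bullet> y\<close>,
  and the mixed terms \<open>y_a y_{s-a}\<close>, summed over \<open>s\<close>, vanish. Order at
  least 5 leaves room for two disjoint pairs, so that norm 2 is attained. On the analytic side the
  obstacle is that polynomials are written in ambient coordinates while the sphere lies in a proper
  subspace, with a measure defined through a chosen orthonormal basis. Hence the moments are
  computed in the coordinates of that basis, but stated for arbitrary ambient vectors.\<close>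

text \<open>A product measure is determined by its values on boxes. The preimage of a box is again a
  box, with sides permuted and some of them reflected, and reflection preserves Lebesgue
  measure.\<close>

lemma distr_signed_permutation:
  fixes \<sigma> :: "'i \<Rightarrow> real"
  assumes "finite I" and \<pi>: "\<pi> permutes I" and \<sigma>: "\<And>i. \<bar>\<sigma> i\<bar> = 1"
  shows "distr (Pi\<^sub>M I (\<lambda>_. lborel)) (Pi\<^sub>M I (\<lambda>_. lborel)) (\<lambda>c. \<lambda>i\<in>I. \<sigma> i * c (\<pi> i))
           = Pi\<^sub>M I (\<lambda>_. lborel)"
proof -
  interpret product_sigma_finite "\<lambda>_::'i. lborel :: real measure" ..
  let ?N = "Pi\<^sub>M I (\<lambda>_. lborel :: real measure)"
  define \<rho> where "\<rho> = inv_into UNIV \<pi>"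
  have \<rho>: "\<rho> permutes I"
    unfolding \<rho>_def by (rule permutes_inv[OF \<pi>])
  have \<pi>I: "\<pi> i \<in> I \<longleftrightarrow> i \<in> I" for i
    using permutes_in_image[OF \<pi>] .
  have invI: "\<rho> i \<in> I \<longleftrightarrow> i \<in> I" for i
    using permutes_in_image[OF \<rho>] .
  have inv: "\<rho> (\<pi> i) = i" "\<pi> (\<rho> i) = i" for i
    using permutes_inverses[OF \<pi>] by (auto simp: \<rho>_def)
  have meas: "(\<lambda>c. \<lambda>i\<in>I. \<sigma> i * c (\<pi> i)) \<in> measurable ?N ?N"
  proof (rule measurable_restrict)
    fix i assume "i \<in> I"
    then have "\<pi> i \<in> I"
      by (simp add: \<pi>I)
    then show "(\<lambda>c. \<sigma> i * c (\<pi> i)) \<in> measurable ?N lborel"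
      by measurable
  qed
  have sign: "emeasure lborel {x. \<sigma> j * x \<in> S} = emeasure lborel S"
    if S: "S \<in> sets borel" for S j
  proof -
    have "\<sigma> j = 1 \<or> \<sigma> j = -1"
      using \<sigma>[of j] by linarith
    then show ?thesis
    proof
      assume "\<sigma> j = -1"
      have "emeasure lborel S = emeasure (distr lborel borel uminus) S"
        by (simp add: lborel_distr_uminus)
      also have "\<dots> = emeasure lborel (uminus -` S)"
        using S by (subst emeasure_distr) auto
      finally show ?thesis
        using \<open>\<sigma> j = -1\<close> by (simp add: vimage_def)
    qed simp
  qed
  show ?thesis
  proof (rule PiM_eqI)
    fix S :: "'i \<Rightarrow> real set"
    assume S: "\<And>i. i \<in> I \<Longrightarrow> S i \<in> sets lborel"
    let ?S' = "\<lambda>i. {x. \<sigma> (\<rho> i) * x \<in> S (\<rho> i)}"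
    have S': "?S' i \<in> sets lborel" if "i \<in> I" for i
    proof -
      have [measurable]: "S (\<rho> i) \<in> sets borel"
        using S invI that by auto
      show ?thesis by simp
    qed
    have "(\<lambda>c. \<lambda>i\<in>I. \<sigma> i * c (\<pi> i)) -` Pi\<^sub>E I S \<inter> space ?N = Pi\<^sub>E I ?S'"
    proof (intro Set.set_eqI iffI)
      fix c assume "c \<in> (\<lambda>c. \<lambda>i\<in>I. \<sigma> i * c (\<pi> i)) -` Pi\<^sub>E I S \<inter> space ?N"
      then have "c \<in> extensional I" and *: "\<And>i. i \<in> I \<Longrightarrow> \<sigma> i * c (\<pi> i) \<in> S i"
        by (auto simp: space_PiM PiE_iff)
      moreover have "c i \<in> ?S' i" if "i \<in> I" for i
        using *[of "\<rho> i"] that invI inv by simp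
      ultimately show "c \<in> Pi\<^sub>E I ?S'"
        by (auto simp: PiE_iff)
    next
      fix c assume c: "c \<in> Pi\<^sub>E I ?S'"
      have "\<sigma> i * c (\<pi> i) \<in> S i" if "i \<in> I" for i
      proof -
        have "c (\<pi> i) \<in> ?S' (\<pi> i)"
          using c \<pi>I that by (intro PiE_mem[of c I ?S']) auto
        then show ?thesis by (simp add: inv)
      qed
      then show "c \<in> (\<lambda>c. \<lambda>i\<in>I. \<sigma> i * c (\<pi> i)) -` Pi\<^sub>E I S \<inter> space ?N"
        using c by (auto simp: space_PiM PiE_iff)
    qed
    then have "emeasure (distr ?N ?N (\<lambda>c. \<lambda>i\<in>I. \<sigma> i * c (\<pi> i))) (Pi\<^sub>E I S) = emeasure ?N (Pi\<^sub>E I ?S')"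
      using S assms(1) by (subst emeasure_distr[OF meas]) (auto intro!: sets_PiM_I_finite)
    also have "\<dots> = (\<Prod>i\<in>I. emeasure lborel (?S' i))"
      using S' assms(1) by (subst emeasure_PiM) auto
    also have "\<dots> = (\<Prod>i\<in>I. emeasure lborel (S (\<rho> i)))"
      using S invI by (intro prod.cong refl sign) auto
    also have "\<dots> = (\<Prod>i\<in>I. emeasure lborel (S i))"
      using permutes_imp_bij[OF \<rho>] by (rule prod.reindex_bij_betw)
    finally show "emeasure (distr ?N ?N (\<lambda>c. \<lambda>i\<in>I. \<sigma> i * c (\<pi> i))) (Pi\<^sub>E I S)
        = (\<Prod>i\<in>I. emeasure lborel (S i))" .
  qed (use assms(1) in auto)
qed

section \<open>Orthonormal coordinates on a subspace and its unit ball\<close>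

text \<open>Integration takes place on the coordinate side, where symmetries of the ball are signed
  permutations. \<open>combo\<close> is the isometry back to the subspace, under which
  \<open>D\<close> corresponds to the unit ball. A nonempty \<open>B\<close> excludes the zero
  subspace, in which the origin is not a null set.\<close>

locale orthonormal_coordinates =
  fixes B :: "'a::euclidean_space set"
  assumes orth: "pairwise orthogonal B" and norm1: "\<And>b. b \<in> B \<Longrightarrow> norm b = 1"
    and nonempty: "B \<noteq> {}"
begin

definition N :: "('a \<Rightarrow> real) measure" where "N = Pi\<^sub>M B (\<lambda>_. lborel)"
definition combo :: "('a \<Rightarrow> real) \<Rightarrow> 'a" where "combo c = (\<Sum>b\<in>B. c b *\<^sub>R b)"
definition r :: "('a \<Rightarrow> real) \<Rightarrow> real" where "r c = sqrt (\<Sum>b\<in>B. (c b)\<^sup>2)"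
definition D :: "('a \<Rightarrow> real) set" where "D = {c \<in> space N. r c \<le> 1}"

lemma finite_B: "finite B"
  using pairwise_orthogonal_imp_finite[OF orth] .

lemma inner_B: "b \<in> B \<Longrightarrow> b' \<in> B \<Longrightarrow> b \<bullet> b' = (if b = b' then 1 else 0)"
  using orth norm1[of b] by (auto simp: pairwise_def orthogonal_def norm_eq_1)

lemma combo_inner: "combo c \<bullet> v = (\<Sum>b\<in>B. c b * (b \<bullet> v))"
  by (simp add: combo_def inner_sum_left)

lemma combo_inner_B: "b \<in> B \<Longrightarrow> combo c \<bullet> b = c b"
  using finite_B by (simp add: combo_inner inner_B if_distrib cong: if_cong)

lemma norm_combo: "norm (combo c) = r c"
proof -
  have "combo c \<bullet> combo c = (\<Sum>b\<in>B. c b * (b \<bullet> combo c))"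
    by (rule combo_inner)
  also have "\<dots> = (\<Sum>b\<in>B. (c b)\<^sup>2)"
    by (intro sum.cong refl) (simp add: combo_inner_B inner_commute[of _ "combo c"] power2_eq_square)
  finally show ?thesis by (simp add: norm_eq_sqrt_inner r_def)
qed

lemma measurable_component [measurable]: "b \<in> B \<Longrightarrow> (\<lambda>c. c b) \<in> borel_measurable N"
  unfolding N_def by measurable

lemma measurable_r [measurable]: "r \<in> borel_measurable N"
  unfolding r_def by measurable

lemma measurable_combo [measurable]: "combo \<in> borel_measurable N"
  unfolding combo_def by measurable

lemma sets_D [measurable]: "D \<in> sets N"
  unfolding D_def by measurable

lemma emeasure_box: 
  assumes "\<And>b. b \<in> B \<Longrightarrow> S b \<in> sets borel"
  shows "emeasure N (Pi\<^sub>E B S) = (\<Prod>b\<in>B. emeasure lborel (S b))"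
proof -
  interpret product_sigma_finite "\<lambda>_::'a. lborel :: real measure" ..
  show ?thesis
    unfolding N_def using finite_B assms by (intro emeasure_PiM) auto
qed

lemma abs_component_le: "b \<in> B \<Longrightarrow> \<bar>c b\<bar> \<le> r c"
  using norm_combo[of c] combo_inner_B[of b c] Cauchy_Schwarz_ineq2[of "combo c" b] norm1[of b] by simp

lemma space_N: "space N = extensional B"
  by (auto simp: N_def space_PiM PiE_def)

lemma emeasure_D_finite: "emeasure N D < \<infinity>"
proof -
  have "D \<subseteq> Pi\<^sub>E B (\<lambda>_. {-1..1})"
  proof
    fix c assume c: "c \<in> D"
    then have "\<bar>c b\<bar> \<le> 1" if "b \<in> B" for b
      using abs_component_le[OF that, of c] by (simp add: D_def)
    then show "c \<in> Pi\<^sub>E B (\<lambda>_. {-1..1})"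
      using c by (auto simp: D_def space_N PiE_iff abs_le_iff minus_le_iff)
  qed
  then have "emeasure N D \<le> emeasure N (Pi\<^sub>E B (\<lambda>_. {-1..1}))"
    using finite_B by (intro emeasure_mono) (auto simp: N_def intro!: sets_PiM_I_finite)
  also have "\<dots> < \<infinity>"
    by (subst emeasure_box) (auto simp: ennreal_power power_less_top_ennreal)
  finally show ?thesis .
qed

text \<open>With \<open>d\<close> coordinates the cube of side \<open>1/d\<close> at the origin fits
  into the ball: each square is at most \<open>1/d\<close> because
  \<open>1/d \<le> 1\<close>.\<close>

lemma emeasure_D_pos: "emeasure N D > 0"
proof -
  define d where "d = real (card B)"
  have d: "d \<ge> 1"
    using finite_B nonempty by (simp add: d_def Suc_le_eq card_gt_0_iff)
  have "c \<in> D" if c: "c \<in> Pi\<^sub>E B (\<lambda>_. {0..1/d})" for c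
  proof -
    have "(c b)\<^sup>2 \<le> 1/d" if "b \<in> B" for b
    proof -
      have "0 \<le> c b" "c b \<le> 1/d"
        using c that by (auto simp: PiE_iff)
      moreover have "1/d \<le> 1"
        using d by simp
      ultimately have "c b * c b \<le> (1/d) * 1"
        by (intro mult_mono) linarith+
      then show ?thesis by (simp add: power2_eq_square)
    qed
    then have "(\<Sum>b\<in>B. (c b)\<^sup>2) \<le> (\<Sum>b\<in>B. 1/d)"
      by (rule sum_mono)
    also have "\<dots> = 1"
      using d by (simp add: d_def)
    finally show ?thesis
      using c by (simp add: D_def r_def space_N PiE_iff)
  qed
  then have "emeasure N (Pi\<^sub>E B (\<lambda>_. {0..1/d})) \<le> emeasure N D"
    by (intro emeasure_mono) auto
  moreover have "emeasure N (Pi\<^sub>E B (\<lambda>_. {0..1/d})) > 0"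
    using d by (subst emeasure_box) (auto simp: ennreal_power)
  ultimately show ?thesis by (rule less_le_trans[rotated])
qed

text \<open>Needed because normalised coordinates have square sum 1 only away from the origin, which
  is the degenerate box with all sides \<open>{0}\<close>.\<close>

lemma AE_r_nonzero: "AE c in N. r c \<noteq> 0"
proof (rule AE_I')
  have "emeasure N (Pi\<^sub>E B (\<lambda>_. {0})) = 0"
    using finite_B nonempty by (subst emeasure_box) (auto simp: card_gt_0_iff)
  then show "Pi\<^sub>E B (\<lambda>_. {0}) \<in> null_sets N"
    using sets_PiM_I_finite[OF finite_B, of "\<lambda>_. {0::real}" "\<lambda>_. lborel"]
    by (simp add: null_sets_def N_def)
  show "{c \<in> space N. \<not> r c \<noteq> 0} \<subseteq> Pi\<^sub>E B (\<lambda>_. {0})"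
  proof
    fix c assume "c \<in> {c \<in> space N. \<not> r c \<noteq> 0}"
    then have c: "c \<in> space N" "r c = 0"
      by auto
    then have "c b = 0" if "b \<in> B" for b
      using abs_component_le[OF that, of c] by simp
    then have "c b \<in> {0}" if "b \<in> B" for b
      using that by simp
    moreover have "c \<in> extensional B"
      using c by (simp add: space_N)
    ultimately show "c \<in> Pi\<^sub>E B (\<lambda>_. {0})"
      unfolding PiE_iff by blast
  qed
qed

section \<open>First and second moments of the normalised coordinates\<close>

definition J :: "(('a \<Rightarrow> real) \<Rightarrow> real) \<Rightarrow> real" where
  "J h = (\<integral>c. indicator D c * h c \<partial>N)"

lemma integrable_on_D:
  assumes [measurable]: "h \<in> borel_measurable N" and "\<And>c. c \<in> D \<Longrightarrow> \<bar>h c :: real\<bar> \<le> K"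
  shows "integrable N (\<lambda>c. indicator D c * h c)"
  by (rule integrableI_bounded_set[where A=D and B=K])
     (use assms emeasure_D_finite in \<open>auto split: split_indicator\<close>)

text \<open>The moments of the ball only need its symmetry under signed coordinate permutations: sign
  changes kill the odd and the mixed moments, transpositions equate the diagonal ones.\<close>

lemma J_signed_permutation:
  assumes \<pi>: "\<pi> permutes B" and \<sigma>: "\<And>b. \<bar>\<sigma> b\<bar> = (1::real)"
    and [measurable]: "h \<in> borel_measurable N"
  shows "J (\<lambda>c. h (\<lambda>b\<in>B. \<sigma> b * c (\<pi> b))) = J h"
proof -
  let ?\<phi> = "\<lambda>c. \<lambda>b\<in>B. \<sigma> b * c (\<pi> b)"
  have \<phi> [measurable]: "?\<phi> \<in> measurable N N"
    unfolding N_def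
  proof (rule measurable_restrict)
    fix b assume "b \<in> B"
    then have [measurable]: "(\<lambda>c. c (\<pi> b)) \<in> borel_measurable (Pi\<^sub>M B (\<lambda>_. lborel))"
      using measurable_component[of "\<pi> b"] permutes_in_image[OF \<pi>] by (simp add: N_def)
    show "(\<lambda>c. \<sigma> b * c (\<pi> b)) \<in> measurable (Pi\<^sub>M B (\<lambda>_. lborel)) lborel"
      by measurable
  qed
  have r: "r (?\<phi> c) = r c" for c
  proof -
    have sq: "(\<sigma> b)\<^sup>2 = 1" for b
      using \<sigma>[of b] by (metis one_power2 power2_abs)
    have "(\<Sum>b\<in>B. (?\<phi> c b)\<^sup>2) = (\<Sum>b\<in>B. (c (\<pi> b))\<^sup>2)"
      by (intro sum.cong) (simp_all add: power_mult_distrib sq)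
    also have "\<dots> = (\<Sum>b\<in>B. (c b)\<^sup>2)"
      using permutes_imp_bij[OF \<pi>] by (rule sum.reindex_bij_betw)
    finally show ?thesis by (simp add: r_def)
  qed
  have D: "?\<phi> c \<in> D \<longleftrightarrow> c \<in> D" if "c \<in> space N" for c
    using r[of c] that by (simp add: D_def space_N)
  have "J h = (\<integral>c. indicator D c * h c \<partial>distr N N ?\<phi>)"
    using distr_signed_permutation[OF finite_B \<pi> \<sigma>] by (simp add: J_def N_def)
  also have "\<dots> = (\<integral>c. indicator D (?\<phi> c) * h (?\<phi> c) \<partial>N)"
    by (rule integral_distr) measurable
  also have "\<dots> = J (\<lambda>c. h (?\<phi> c))"
    unfolding J_def using D by (intro Bochner_Integration.integral_cong) (auto simp: indicator_def)
  finally show ?thesis by simp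
qed

text \<open>A coordinate of the radial projection to the unit sphere. At the origin division by zero
  gives 0, so the bound by 1 holds everywhere.\<close>

definition u :: "'a \<Rightarrow> ('a \<Rightarrow> real) \<Rightarrow> real" where "u b c = c b / r c"

lemma measurable_u [measurable]: "b \<in> B \<Longrightarrow> u b \<in> borel_measurable N"
  unfolding u_def by measurable

lemma abs_u_le: "b \<in> B \<Longrightarrow> \<bar>u b c\<bar> \<le> 1"
  using abs_component_le[of b c] by (auto simp: u_def divide_le_eq_1)

lemma J_flip:
  assumes b: "b \<in> B" and [measurable]: "h \<in> borel_measurable N"
  shows "J (\<lambda>c. h (\<lambda>b'\<in>B. (if b' = b then -1 else 1) * c b')) = J h"
  using J_signed_permutation[OF permutes_id, of "\<lambda>b'. if b' = b then -1 else 1" h] by simp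

lemma r_flip: "r (\<lambda>b'\<in>B. (if b' = b then -1 else 1) * c b') = r c"
  by (auto simp: r_def intro!: arg_cong[of _ _ sqrt] sum.cong)

lemma J_minus: "J (\<lambda>c. - h c) = - J h"
  by (simp add: J_def)

lemma J_u: assumes "b \<in> B" shows "J (u b) = 0"
proof -
  have "J (u b) = J (\<lambda>c. - u b c)"
    using J_flip[OF assms measurable_u[OF assms]] assms by (simp add: u_def r_flip)
  then show ?thesis by (simp add: J_minus)
qed

lemma J_u_u_offdiag:
  assumes "b \<in> B" "b' \<in> B" "b \<noteq> b'" shows "J (\<lambda>c. u b c * u b' c) = 0"
proof -
  have [measurable]: "u b \<in> borel_measurable N" "u b' \<in> borel_measurable N"
    using assms by auto
  have "J (\<lambda>c. u b c * u b' c) = J (\<lambda>c. - (u b c * u b' c))"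
    using J_flip[OF assms(1), of "\<lambda>c. u b c * u b' c"] assms by (simp add: u_def r_flip)
  then show ?thesis by (simp only: J_minus)
qed

lemma J_u_sq_eq:
  assumes "b \<in> B" "b' \<in> B" shows "J (\<lambda>c. (u b c)\<^sup>2) = J (\<lambda>c. (u b' c)\<^sup>2)"
proof -
  let ?\<pi> = "Transposition.transpose b b'"
  have \<pi>: "?\<pi> permutes B"
    using assms by (rule permutes_swap_id)
  have r: "r (\<lambda>b\<in>B. c (?\<pi> b)) = r c" for c
  proof -
    have "(\<Sum>b\<in>B. (c (?\<pi> b))\<^sup>2) = (\<Sum>b\<in>B. (c b)\<^sup>2)"
      using permutes_imp_bij[OF \<pi>] by (rule sum.reindex_bij_betw)
    then show ?thesis by (simp add: r_def)
  qed
  have [measurable]: "u b \<in> borel_measurable N" "u b' \<in> borel_measurable N"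
    using assms by auto
  show ?thesis
    using J_signed_permutation[OF \<pi>, of "\<lambda>_. 1" "\<lambda>c. (u b c)\<^sup>2"] assms by (simp add: u_def r)
qed

lemma integrable_u_u:
  assumes "b \<in> B" "b' \<in> B" shows "integrable N (\<lambda>c. indicator D c * (u b c * u b' c))"
proof -
  have [measurable]: "u b \<in> borel_measurable N" "u b' \<in> borel_measurable N"
    using assms by auto
  have "\<bar>u b c * u b' c\<bar> \<le> 1" for c
    using mult_mono[OF abs_u_le abs_u_le, OF assms] by (simp add: abs_mult)
  then show ?thesis
    by (intro integrable_on_D[where K=1]) auto
qed

lemma integrable_u: "b \<in> B \<Longrightarrow> integrable N (\<lambda>c. indicator D c * u b c)"
  using abs_u_le by (intro integrable_on_D[where K=1]) auto

lemma J_one: "J (\<lambda>_. 1) = measure N D"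
  by (simp add: J_def sets.Int_space_eq2)

text \<open>All diagonal moments agree by symmetry, and the squares of the \<open>u b\<close> add up
  to 1 almost everywhere; so each moment is the volume divided by \<open>card B\<close>, and no
  integral has to be evaluated.\<close>

lemma J_u_sq: assumes "b \<in> B" shows "real (card B) * J (\<lambda>c. (u b c)\<^sup>2) = measure N D"
proof -
  have "real (card B) * J (\<lambda>c. (u b c)\<^sup>2) = (\<Sum>b'\<in>B. J (\<lambda>c. (u b' c)\<^sup>2))"
    using sum.cong[OF refl J_u_sq_eq[OF assms], of B] by simp
  also have "\<dots> = (\<integral>c. (\<Sum>b'\<in>B. indicator D c * (u b' c)\<^sup>2) \<partial>N)"
    unfolding J_def power2_eq_square
    by (rule Bochner_Integration.integral_sum[symmetric]) (rule integrable_u_u)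
  also have "\<dots> = J (\<lambda>_. 1)"
    unfolding J_def
  proof (rule integral_cong_AE)
    show "(\<lambda>c. \<Sum>b'\<in>B. indicator D c * (u b' c)\<^sup>2) \<in> borel_measurable N"
      by (intro borel_measurable_sum borel_measurable_times borel_measurable_power) auto
    show "AE c in N. (\<Sum>b'\<in>B. indicator D c * (u b' c)\<^sup>2) = indicator D c * 1"
      using AE_r_nonzero
    proof eventually_elim
      case (elim c)
      have "r c ^ 2 = (\<Sum>b\<in>B. (c b)\<^sup>2)"
        by (simp add: r_def sum_nonneg)
      then have "(\<Sum>b\<in>B. (u b c)\<^sup>2) = 1"
        using elim by (simp add: u_def power_divide flip: sum_divide_distrib) (metis power_not_zero)
      then show ?case
        by (simp flip: sum_distrib_left)
    qed
  qed auto
  finally show ?thesis by (simp add: J_one)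
qed

section \<open>Transfer of the moments to the ambient space\<close>

definition ball_integral :: "('a \<Rightarrow> real) \<Rightarrow> real" where
  "ball_integral f = (LINT x : cball 0 1 | distr N borel combo. f (x /\<^sub>R norm x))"

lemma measurable_normalize [measurable]: "(\<lambda>x::'a. x /\<^sub>R norm x) \<in> borel_measurable borel"
  by (intro borel_measurable_scaleR borel_measurable_inverse borel_measurable_norm) auto

lemma sets_cball [measurable]: "cball (0::'a) 1 \<in> sets borel"
  by simp

lemma combo_in_cball: "c \<in> space N \<Longrightarrow> combo c \<in> cball 0 1 \<longleftrightarrow> c \<in> D"
  by (simp add: D_def norm_combo)

lemma ball_integral_eq:
  assumes [measurable]: "f \<in> borel_measurable borel"
  shows "ball_integral f = J (\<lambda>c. f (combo c /\<^sub>R r c))"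
proof -
  have "ball_integral f = (\<integral>c. indicator (cball 0 1) (combo c) *\<^sub>R f (combo c /\<^sub>R norm (combo c)) \<partial>N)"
    unfolding ball_integral_def set_lebesgue_integral_def by (rule integral_distr) measurable
  also have "\<dots> = J (\<lambda>c. f (combo c /\<^sub>R r c))"
    unfolding J_def
    by (intro Bochner_Integration.integral_cong refl)
       (simp add: norm_combo D_def indicator_def)
  finally show ?thesis .
qed

lemma ball_volume: "measure (distr N borel combo) (cball 0 1) = measure N D"
proof -
  have "combo -` cball 0 1 \<inter> space N = D"
    using combo_in_cball by (auto simp: D_def simp del: mem_cball)
  then show ?thesis
    by (simp add: measure_distr)
qed

lemma ball_volume_pos: "measure N D > 0"
  using emeasure_D_pos emeasure_D_finite by (simp add: measure_def enn2real_positive_iff)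

lemma unit_combo_inner: "(combo c /\<^sub>R r c) \<bullet> v = (\<Sum>b\<in>B. u b c * (b \<bullet> v))"
  by (simp add: combo_inner u_def sum_distrib_left divide_inverse algebra_simps)

lemma ball_integral_one: "ball_integral (\<lambda>_. 1) = measure N D"
  by (simp add: ball_integral_eq J_one)

lemma ball_integral_inner: "ball_integral (\<lambda>x. x \<bullet> v) = 0"
proof -
  have "ball_integral (\<lambda>x. x \<bullet> v) = J (\<lambda>c. \<Sum>b\<in>B. u b c * (b \<bullet> v))"
    by (simp only: ball_integral_eq borel_measurable_inner measurable_ident_sets borel_measurable_const measurable_ident unit_combo_inner)
  also have "\<dots> = (\<integral>c. (\<Sum>b\<in>B. (indicator D c * u b c) * (b \<bullet> v)) \<partial>N)"
    unfolding J_def by (intro Bochner_Integration.integral_cong) (simp_all add: sum_distrib_left mult.assoc)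
  also have "\<dots> = (\<Sum>b\<in>B. J (u b) * (b \<bullet> v))"
    unfolding J_def
    by (subst Bochner_Integration.integral_sum) (auto intro!: integrable_mult_left integrable_u)
  also have "\<dots> = 0"
    by (simp add: J_u)
  finally show ?thesis .
qed

text \<open>Expanding both factors in \<open>B\<close> leaves only diagonal moments, all equal.
  Since \<open>v\<close> and \<open>w\<close> may lie outside \<open>span B\<close>, the right-hand
  sum is the inner product of their orthogonal projections and not
  \<open>v \<bullet> w\<close>.\<close>

lemma ball_integral_inner_inner:
  "real (card B) * ball_integral (\<lambda>x. (x \<bullet> v) * (x \<bullet> w)) = measure N D * (\<Sum>b\<in>B. (b \<bullet> v) * (b \<bullet> w))"
proof -
  have "ball_integral (\<lambda>x. (x \<bullet> v) * (x \<bullet> w))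
      = J (\<lambda>c. (\<Sum>b\<in>B. u b c * (b \<bullet> v)) * (\<Sum>b\<in>B. u b c * (b \<bullet> w)))"
    by (subst ball_integral_eq) (measurable, simp only: unit_combo_inner)
  also have "\<dots> = (\<integral>c. (\<Sum>b\<in>B. \<Sum>b'\<in>B. (indicator D c * (u b c * u b' c)) * ((b \<bullet> v) * (b' \<bullet> w))) \<partial>N)"
    unfolding J_def sum_product
    by (intro Bochner_Integration.integral_cong) (simp_all add: sum_distrib_left mult_ac)
  also have "\<dots> = (\<Sum>b\<in>B. \<Sum>b'\<in>B. J (\<lambda>c. u b c * u b' c) * ((b \<bullet> v) * (b' \<bullet> w)))"
    unfolding J_def
    by (simp add: Bochner_Integration.integral_sum integrable_u_u Bochner_Integration.integrable_sum integrable_mult_left)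
  also have "\<dots> = (\<Sum>b\<in>B. \<Sum>b'\<in>B. if b' = b then J (\<lambda>c. (u b c)\<^sup>2) * ((b \<bullet> v) * (b \<bullet> w)) else 0)"
    by (intro sum.cong refl) (auto simp: J_u_u_offdiag power2_eq_square)
  also have "\<dots> = (\<Sum>b\<in>B. J (\<lambda>c. (u b c)\<^sup>2) * ((b \<bullet> v) * (b \<bullet> w)))"
    by (intro sum.cong refl) (simp add: sum.delta' finite_B)
  finally have "real (card B) * ball_integral (\<lambda>x. (x \<bullet> v) * (x \<bullet> w))
      = (\<Sum>b\<in>B. (real (card B) * J (\<lambda>c. (u b c)\<^sup>2)) * ((b \<bullet> v) * (b \<bullet> w)))"
    by (simp add: sum_distrib_left mult.assoc)
  also have "\<dots> = measure N D * (\<Sum>b\<in>B. (b \<bullet> v) * (b \<bullet> w))"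
    by (simp add: J_u_sq sum_distrib_left)
  finally show ?thesis .
qed

lemma emeasure_ball_finite: "emeasure (distr N borel combo) (cball 0 1) < \<infinity>"
proof -
  have "combo -` cball 0 1 \<inter> space N = D"
    using combo_in_cball by (auto simp: D_def simp del: mem_cball)
  then show ?thesis
    using emeasure_D_finite by (simp add: emeasure_distr)
qed

text \<open>Linearity needs integrability, which follows from boundedness on a set of finite
  measure. A bound on the unit ball suffices, since a normalised point has norm 1, or 0 at the
  origin.\<close>

lemma ball_integral_sum:
  assumes [measurable]: "\<And>e. e \<in> E \<Longrightarrow> f e \<in> borel_measurable borel"
    and bd: "\<And>e x. e \<in> E \<Longrightarrow> norm x \<le> 1 \<Longrightarrow> \<bar>f e x\<bar> \<le> 1"
  shows "ball_integral (\<lambda>x. \<Sum>e\<in>E. k e * f e x) = (\<Sum>e\<in>E. k e * ball_integral (f e))"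
proof -
  have "integrable (distr N borel combo) (\<lambda>x. indicator (cball 0 1) x * f e (x /\<^sub>R norm x))"
    if e: "e \<in> E" for e
  proof (rule integrableI_bounded_set[where A="cball 0 1" and B=1])
    have [measurable]: "f e \<in> borel_measurable borel"
      using e by simp
    have "(\<lambda>x. indicator (cball 0 1) x * f e (x /\<^sub>R norm x)) \<in> borel_measurable borel"
      by measurable
    then show "(\<lambda>x. indicator (cball 0 1) x * f e (x /\<^sub>R norm x)) \<in> borel_measurable (distr N borel combo)"
      by simp
    have "norm (x /\<^sub>R norm x) \<le> 1" for x :: 'a
      by (cases "x = 0") auto
    then show "AE x in distr N borel combo. x \<in> cball 0 1 \<longrightarrow> norm (indicator (cball 0 1) x * f e (x /\<^sub>R norm x)) \<le> 1"
      using bd[OF e] by (auto split: split_indicator)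
  qed (use emeasure_ball_finite in auto)
  note int = integrable_mult_right[OF this]
  have "ball_integral (\<lambda>x. \<Sum>e\<in>E. k e * f e x)
     = (\<integral>x. (\<Sum>e\<in>E. k e * (indicator (cball 0 1) x * f e (x /\<^sub>R norm x))) \<partial>distr N borel combo)"
    unfolding ball_integral_def set_lebesgue_integral_def
    by (intro Bochner_Integration.integral_cong) (simp_all add: sum_distrib_left mult_ac)
  also have "\<dots> = (\<Sum>e\<in>E. k e * ball_integral (f e))"
    unfolding ball_integral_def set_lebesgue_integral_def
    using int by (subst Bochner_Integration.integral_sum) auto
  finally show ?thesis .
qed

end

section \<open>Polynomials of degree at most 2 and the design criterion\<close>

text \<open>Basis vectors with positive exponent are split off one at a time until the degree is 0;
  \<open>a\<close> and \<open>a'\<close> may coincide. This puts monomials into the form in which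
  the ball moments are known.\<close>

lemma monomial_degree_le_2_cases:
  fixes e :: "'a::euclidean_space \<Rightarrow> nat"
  assumes "(\<Sum>b\<in>Basis. e b) \<le> 2"
  obtains "\<And>x::'a. (\<Prod>b\<in>Basis. (x \<bullet> b) ^ e b) = 1"
  | a where "\<And>x::'a. (\<Prod>b\<in>Basis. (x \<bullet> b) ^ e b) = x \<bullet> a"
  | a a' where "\<And>x::'a. (\<Prod>b\<in>Basis. (x \<bullet> b) ^ e b) = (x \<bullet> a) * (x \<bullet> a')"
proof -
  have split: "\<exists>a e'. (\<Sum>b\<in>Basis. e' b) = k \<and>
      (\<forall>x::'a. (\<Prod>b\<in>Basis. (x \<bullet> b) ^ e b) = (x \<bullet> a) * (\<Prod>b\<in>Basis. (x \<bullet> b) ^ e' b))"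
    if "(\<Sum>b\<in>Basis. e b) = Suc k" for e :: "'a \<Rightarrow> nat" and k
  proof -
    obtain a where a: "a \<in> Basis" "e a \<noteq> 0"
      using \<open>_ = Suc k\<close> by (metis sum.neutral nat.distinct(1))
    then obtain m where m: "e a = Suc m"
      using not0_implies_Suc by blast
    have "(\<Sum>b\<in>Basis. (e(a := m)) b) = k"
      using \<open>_ = Suc k\<close> m by (simp add: sum.remove[OF finite_Basis a(1)])
    moreover have "(\<Prod>b\<in>Basis. (x \<bullet> b) ^ e b) = (x \<bullet> a) * (\<Prod>b\<in>Basis. (x \<bullet> b) ^ (e(a := m)) b)" for x :: 'a
      using m by (simp add: prod.remove[OF finite_Basis a(1)])
    ultimately show ?thesis by blast
  qed
  have zero: "(\<Prod>b\<in>Basis. (x \<bullet> b) ^ e b) = 1" if "(\<Sum>b\<in>Basis. e b) = 0"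
    for x :: 'a and e :: "'a \<Rightarrow> nat"
    using that by simp
  consider "(\<Sum>b\<in>Basis. e b) = 0" | "(\<Sum>b\<in>Basis. e b) = Suc 0" | "(\<Sum>b\<in>Basis. e b) = Suc (Suc 0)"
    using assms by linarith
  then show ?thesis
  proof cases
    case 1
    then show ?thesis using that(1) zero by blast
  next
    case 2
    then obtain a e' where "(\<Sum>b\<in>Basis. e' b) = 0"
      and "\<forall>x::'a. (\<Prod>b\<in>Basis. (x \<bullet> b) ^ e b) = (x \<bullet> a) * (\<Prod>b\<in>Basis. (x \<bullet> b) ^ e' b)"
      using split[OF 2] by blast
    then show ?thesis using that(2)[of a] zero[of e'] by simp
  next
    case 3
    then obtain a e' where e': "(\<Sum>b\<in>Basis. e' b) = Suc 0"
      and 1: "\<forall>x::'a. (\<Prod>b\<in>Basis. (x \<bullet> b) ^ e b) = (x \<bullet> a) * (\<Prod>b\<in>Basis. (x \<bullet> b) ^ e' b)"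
      using split[OF 3] by blast
    obtain a' e'' where "(\<Sum>b\<in>Basis. e'' b) = 0"
      and "\<forall>x::'a. (\<Prod>b\<in>Basis. (x \<bullet> b) ^ e' b) = (x \<bullet> a') * (\<Prod>b\<in>Basis. (x \<bullet> b) ^ e'' b)"
      using split[OF e'] by blast
    then show ?thesis using that(3)[of a a'] 1 zero[of e''] by simp
  qed
qed

text \<open>Vanishing sum handles degree 1 and the quadratic identity degree 2. The constant
  \<open>K\<close> can be left open because taking the trace over an orthonormal basis forces
  \<open>K * dim V = card X\<close>.\<close>

lemma spherical_2_design_criterion:
  fixes V :: "'a::euclidean_space set"
  assumes V: "subspace V" and X: "finite X" "X \<noteq> {}" "X \<subseteq> V \<inter> sphere 0 1"
    and sum0: "\<Sum>X = 0"
    and eut: "\<And>y. y \<in> V \<Longrightarrow> (\<Sum>x\<in>X. (x \<bullet> y)\<^sup>2) = K * (y \<bullet> y)"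
  shows "spherical_design 2 V X"
proof -
  \<comment> \<open>The very choice made inside \<open>subspace_lborel\<close>, so that this measure
    unfolds to the image of \<open>N\<close> under \<open>combo\<close>.\<close>
  define B where "B = (SOME B. orthonormal_basis_of V B)"
  have "\<exists>B. orthonormal_basis_of V B"
    using orthonormal_basis_subspace[OF V] unfolding orthonormal_basis_of_def by metis
  then have B: "orthonormal_basis_of V B"
    unfolding B_def by (rule someI_ex)
  then have "B \<noteq> {}"
    using X by (force simp: orthonormal_basis_of_def)
  with B interpret orthonormal_coordinates B
    by unfold_locales (auto simp: orthonormal_basis_of_def)
  have BV: "B \<subseteq> V" and span: "span B = V"
    using B by (auto simp: orthonormal_basis_of_def)
  have M: "subspace_lborel V = distr N borel combo"
    by (simp add: subspace_lborel_def B_def[symmetric] N_def combo_def[abs_def])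
  define vol where "vol = measure N D"
  have vol: "vol > 0"
    using ball_volume_pos by (simp add: vol_def)
  have avg: "sphere_average V f = ball_integral f / vol" for f
    by (simp add: sphere_average_def M ball_integral_def ball_volume vol_def)
  have expand: "(\<Sum>b\<in>B. (x \<bullet> b) *\<^sub>R b) = x" if "x \<in> V" for x
    using orthonormal_basis_expand[OF orth norm1 _ finite_B] that span by simp
  have inner_V: "(\<Sum>b\<in>B. (x \<bullet> b) * (b \<bullet> y)) = x \<bullet> y" if "x \<in> V" for x y
  proof -
    have "x \<bullet> y = (\<Sum>b\<in>B. (x \<bullet> b) *\<^sub>R b) \<bullet> y"
      using expand[OF that] by simp
    then show ?thesis by (simp add: inner_sum_left)
  qed
  have cX: "real (card X) > 0"
    using X by (simp add: card_gt_0_iff)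
  have polar: "(\<Sum>x\<in>X. (x \<bullet> y) * (x \<bullet> z)) = K * (y \<bullet> z)" if "y \<in> V" "z \<in> V" for y z
  proof -
    have "(\<Sum>x\<in>X. (x \<bullet> (y + z))\<^sup>2) = (\<Sum>x\<in>X. (x \<bullet> y)\<^sup>2) + 2 * (\<Sum>x\<in>X. (x \<bullet> y) * (x \<bullet> z)) + (\<Sum>x\<in>X. (x \<bullet> z)\<^sup>2)"
      by (simp add: inner_add_right power2_sum sum.distrib sum_distrib_left mult_ac)
    moreover have "y + z \<in> V"
      using V that by (rule subspace_add)
    ultimately have "K * ((y + z) \<bullet> (y + z)) = K * (y \<bullet> y) + 2 * (\<Sum>x\<in>X. (x \<bullet> y) * (x \<bullet> z)) + K * (z \<bullet> z)"
      using that by (simp only: eut)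
    then show ?thesis
      by (simp add: inner_add_left inner_add_right inner_commute[of z y] distrib_left)
  qed
  \<comment> \<open>The trace of the eutaxy identity: sum it over \<open>y \<in> B\<close> and use
    that every \<open>x \<in> X\<close> has norm 1.\<close>
  have KB: "K * real (card B) = real (card X)"
  proof -
    have "K * real (card B) = (\<Sum>b\<in>B. K * (b \<bullet> b))"
      by (simp add: inner_B)
    also have "\<dots> = (\<Sum>b\<in>B. \<Sum>x\<in>X. (x \<bullet> b)\<^sup>2)"
      using BV by (intro sum.cong refl) (simp add: eut subset_iff)
    also have "\<dots> = (\<Sum>x\<in>X. \<Sum>b\<in>B. (x \<bullet> b) * (b \<bullet> x))"
      by (subst sum.swap) (simp add: power2_eq_square inner_commute)
    also have "\<dots> = (\<Sum>x\<in>X. 1)"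
    proof (rule sum.cong)
      fix x assume "x \<in> X"
      then have "x \<in> V" "norm x = 1"
        using X by auto
      then show "(\<Sum>b\<in>B. (x \<bullet> b) * (b \<bullet> x)) = 1"
        by (simp add: inner_V norm_eq_1)
    qed simp
    finally show ?thesis by simp
  qed
  \<comment> \<open>The ambient basis vectors need not lie in \<open>V\<close>, where alone the
    identity is assumed. So each \<open>x\<close> is expanded in \<open>B\<close> and the polarised
    identity is applied to pairs from \<open>B\<close>.\<close>
  have second: "(\<Sum>x\<in>X. (x \<bullet> v) * (x \<bullet> w)) = K * (\<Sum>b\<in>B. (b \<bullet> v) * (b \<bullet> w))" for v w
  proof -
    have "(\<Sum>x\<in>X. (x \<bullet> v) * (x \<bullet> w)) = (\<Sum>x\<in>X. (\<Sum>b\<in>B. (x \<bullet> b) * (b \<bullet> v)) * (\<Sum>b\<in>B. (x \<bullet> b) * (b \<bullet> w)))"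
      using X inner_V by (intro sum.cong refl) (auto simp: subset_iff)
    also have "\<dots> = (\<Sum>x\<in>X. \<Sum>b\<in>B. \<Sum>b'\<in>B. ((x \<bullet> b) * (x \<bullet> b')) * ((b \<bullet> v) * (b' \<bullet> w)))"
      by (simp add: sum_product mult_ac)
    also have "\<dots> = (\<Sum>b\<in>B. \<Sum>b'\<in>B. \<Sum>x\<in>X. ((x \<bullet> b) * (x \<bullet> b')) * ((b \<bullet> v) * (b' \<bullet> w)))"
      by (subst sum.swap) (intro sum.cong refl sum.swap)
    also have "\<dots> = (\<Sum>b\<in>B. \<Sum>b'\<in>B. if b' = b then K * ((b \<bullet> v) * (b \<bullet> w)) else 0)"
      using BV by (intro sum.cong refl) (auto simp: polar subset_iff inner_B simp flip: sum_distrib_right)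
    also have "\<dots> = K * (\<Sum>b\<in>B. (b \<bullet> v) * (b \<bullet> w))"
      by (simp add: finite_B sum_distrib_left)
    finally show ?thesis .
  qed
  have moments: "ball_integral f / vol = (\<Sum>x\<in>X. f x) / real (card X)"
    if e: "(\<Sum>b\<in>Basis. e b) \<le> 2" and f: "f = (\<lambda>x. \<Prod>b\<in>Basis. (x \<bullet> b) ^ e b)" for e f
    using e
  proof (cases rule: monomial_degree_le_2_cases)
    case 1
    then show ?thesis
      using vol cX by (simp add: f ball_integral_one flip: vol_def)
  next
    case (2 a)
    have "(\<Sum>x\<in>X. x \<bullet> a) = 0"
      using sum0 by (simp flip: inner_sum_left)
    then show ?thesis
      by (simp add: f 2 ball_integral_inner)
  next
    case (3 a a')
    have "real (card B) \<noteq> 0"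
      using finite_B nonempty by simp
    then have "ball_integral f = vol * (\<Sum>b\<in>B. (b \<bullet> a) * (b \<bullet> a')) / real (card B)"
      using ball_integral_inner_inner[of a a'] by (simp add: f 3 vol_def field_simps)
    moreover have "K \<noteq> 0"
      using KB cX by auto
    ultimately show ?thesis
      using vol cX \<open>real (card B) \<noteq> 0\<close> by (simp add: f 3 second flip: KB)
  qed
  have "sphere_average V f = (\<Sum>x\<in>X. f x) / real (card X)" if "poly_degree_le 2 f" for f
  proof -
    define E :: "('a \<Rightarrow> nat) set" where
      "E = {e. (\<forall>b. b \<notin> Basis \<longrightarrow> e b = 0) \<and> (\<Sum>b\<in>Basis. e b) \<le> 2}"
    define mon where "mon e x = (\<Prod>b\<in>Basis. (x \<bullet> b) ^ e b)" for e and x :: 'a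
    obtain k where "\<forall>x. f x = (\<Sum>e\<in>E. k e * mon e x)"
      using \<open>poly_degree_le 2 f\<close> unfolding poly_degree_le_def E_def mon_def by blast
    then have f: "f = (\<lambda>x. \<Sum>e\<in>E. k e * mon e x)"
      by auto
    have "\<bar>mon e x\<bar> \<le> 1" if "norm x \<le> 1" for e x
      unfolding mon_def abs_prod power_abs
      using Basis_le_norm[of _ x] that by (intro prod_le_1 conjI power_le_one) (auto intro: order_trans)
    moreover have "mon e \<in> borel_measurable borel" for e
      unfolding mon_def[abs_def] by measurable
    ultimately have "ball_integral f / vol = (\<Sum>e\<in>E. k e * (ball_integral (mon e) / vol))"
      unfolding f by (subst ball_integral_sum) (auto simp: sum_divide_distrib)
    also have "\<dots> = (\<Sum>e\<in>E. k e * ((\<Sum>x\<in>X. mon e x) / real (card X)))"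
      by (intro sum.cong refl arg_cong2[where f="(*)"] moments) (auto simp: E_def mon_def)
    also have "\<dots> = (\<Sum>x\<in>X. f x) / real (card X)"
      unfolding f by (subst sum.swap) (simp add: sum_distrib_left sum_divide_distrib)
    finally show ?thesis by (simp add: avg)
  qed
  then show ?thesis
    using X by (simp add: spherical_design_def)
qed

subsection \<open>Minimal vectors and eutaxy of the group lattice\<close>

text \<open>The bound 4 is the square of the minimal norm 2. The first shape, of squared norm 2, is
  the one that the group condition later rules out.\<close>

lemma small_sum_zero_vector_cases:
  fixes z :: "'n::finite \<Rightarrow> int"
  assumes "(\<Sum>i\<in>UNIV. z i) = 0" and "(\<Sum>i\<in>UNIV. (z i)\<^sup>2) \<le> 4" and "z \<noteq> (\<lambda>_. 0)"
  obtains a b where "a \<noteq> b" "z = (\<lambda>i. of_bool (i = a) - of_bool (i = b))"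
  | a b c d where "distinct [a, b, c, d]"
      "z = (\<lambda>i. of_bool (i = a) + of_bool (i = b) - of_bool (i = c) - of_bool (i = d))"
proof -
  have step: "\<exists>a c. w a \<ge> 1 \<and> w c \<le> -1 \<and>
      (\<Sum>i\<in>UNIV. w i - of_bool (i = a) + of_bool (i = c)) = 0 \<and>
      (\<Sum>i\<in>UNIV. (w i - of_bool (i = a) + of_bool (i = c))\<^sup>2) = (\<Sum>i\<in>UNIV. (w i)\<^sup>2) - 2 * w a + 2 * w c + 2"
    if w: "(\<Sum>i\<in>UNIV. w i) = 0" "w \<noteq> (\<lambda>_. 0)" for w :: "'n \<Rightarrow> int"
  proof -
    have "\<exists>a. w a \<ge> 1"
    proof (rule ccontr)
      assume "\<nexists>a. w a \<ge> 1"
      then have "\<And>i. w i \<le> 0" by (meson int_one_le_iff_zero_less not_less)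
      then show False
        using w sum_nonneg_eq_0_iff[of UNIV "\<lambda>i. - w i"] by (auto simp: sum_negf)
    qed
    moreover have "\<exists>c. w c \<le> -1"
    proof (rule ccontr)
      assume "\<nexists>c. w c \<le> -1"
      then have "\<And>i. w i \<ge> 0" by (metis linorder_not_le zle_add1_eq_le add.left_inverse)
      then show False
        using w sum_nonneg_eq_0_iff[of UNIV w] by auto
    qed
    ultimately obtain a c where ac: "w a \<ge> 1" "w c \<le> -1" by blast
    then have "a \<noteq> c" by auto
    have 1: "(\<Sum>i\<in>UNIV. w i - of_bool (i = a) + of_bool (i = c)) = 0"
      using w by (simp add: sum.distrib sum_subtractf)
    have "(w i - of_bool (i = a) + of_bool (i = c))\<^sup>2
        = (w i)\<^sup>2 + (if i = a then 1 - 2 * w i else 0) + (if i = c then 1 + 2 * w i else 0)" for i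
      using \<open>a \<noteq> c\<close> by (auto simp: power2_eq_square algebra_simps)
    then have "(\<Sum>i\<in>UNIV. (w i - of_bool (i = a) + of_bool (i = c))\<^sup>2)
        = (\<Sum>i\<in>UNIV. (w i)\<^sup>2) - 2 * w a + 2 * w c + 2"
      by (simp add: sum.distrib)
    with 1 ac show ?thesis by blast
  qed
  \<comment> \<open>Moving one unit from a positive to a negative entry lowers the sum of squares by at least 2,
    so after at most two moves nothing is left.\<close>
  obtain a c where ac: "z a \<ge> 1" "z c \<le> -1"
    and w1: "(\<Sum>i\<in>UNIV. z i - of_bool (i = a) + of_bool (i = c)) = 0"
    and w2: "(\<Sum>i\<in>UNIV. (z i - of_bool (i = a) + of_bool (i = c))\<^sup>2) = (\<Sum>i\<in>UNIV. (z i)\<^sup>2) - 2 * z a + 2 * z c + 2"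
    using step[OF assms(1,3)] by blast
  define w where "w = (\<lambda>i. z i - of_bool (i = a) + of_bool (i = c))"
  have "a \<noteq> c" using ac by auto
  have z: "z i = w i + of_bool (i = a) - of_bool (i = c)" for i
    by (simp add: w_def)
  show ?thesis
  proof (cases "w = (\<lambda>_. 0)")
    case True
    then have "z = (\<lambda>i. of_bool (i = a) - of_bool (i = c))"
      using z by (auto simp: fun_eq_iff)
    with \<open>a \<noteq> c\<close> show ?thesis using that(1) by blast
  next
    case False
    obtain b d where bd: "w b \<ge> 1" "w d \<le> -1"
      and v2: "(\<Sum>i\<in>UNIV. (w i - of_bool (i = b) + of_bool (i = d))\<^sup>2) = (\<Sum>i\<in>UNIV. (w i)\<^sup>2) - 2 * w b + 2 * w d + 2"
      using step[OF w1[folded w_def] False] by blast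
    have nn: "(\<Sum>i\<in>UNIV. (w i - of_bool (i = b) + of_bool (i = d))\<^sup>2) \<ge> 0"
      by (simp add: sum_nonneg)
    have w2': "(\<Sum>i\<in>UNIV. (w i)\<^sup>2) = (\<Sum>i\<in>UNIV. (z i)\<^sup>2) - 2 * z a + 2 * z c + 2"
      using w2 by (simp add: w_def)
    \<comment> \<open>Each of the two moves lowers the sum of squares by at least 2, starting from
      at most 4 and ending at least at 0. Hence every inequality is an equality.\<close>
    have ones: "z a = 1" "z c = -1" "(\<Sum>i\<in>UNIV. (w i - of_bool (i = b) + of_bool (i = d))\<^sup>2) = 0"
      using nn v2 w2' bd ac assms(2) by linarith+
    then have "w i = of_bool (i = b) - of_bool (i = d)" for i
      using sum_nonneg_eq_0_iff[of UNIV "\<lambda>i. (w i - of_bool (i = b) + of_bool (i = d))\<^sup>2"]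
      by (simp add: algebra_simps eq_diff_eq)
    then have "z = (\<lambda>i. of_bool (i = a) + of_bool (i = b) - of_bool (i = c) - of_bool (i = d))"
      using z by (auto simp: fun_eq_iff)
    moreover have "w a = 0" "w c = 0"
      using ones \<open>a \<noteq> c\<close> by (auto simp: w_def)
    then have "distinct [a, b, c, d]"
      using bd \<open>a \<noteq> c\<close> by auto
    ultimately show ?thesis using that(2) by blast
  qed
qed

text \<open>The variance identity: the sum over all pairs depends only on the first two power sums
  of \<open>h\<close>.\<close>

lemma sum_sum_diff_squares:
  fixes h :: "'i \<Rightarrow> real"
  shows "(\<Sum>a\<in>K. \<Sum>c\<in>K. (h a - h c)\<^sup>2) = 2 * real (card K) * (\<Sum>a\<in>K. (h a)\<^sup>2) - 2 * (\<Sum>a\<in>K. h a)\<^sup>2"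
proof -
  have "(\<Sum>a\<in>K. \<Sum>c\<in>K. (h a - h c)\<^sup>2)
      = (\<Sum>a\<in>K. \<Sum>c\<in>K. (h a)\<^sup>2) + (\<Sum>a\<in>K. \<Sum>c\<in>K. (h c)\<^sup>2) - 2 * (\<Sum>a\<in>K. \<Sum>c\<in>K. h a * h c)"
    by (simp add: power2_diff sum.distrib sum_subtractf sum_distrib_left mult_ac)
  also have "(\<Sum>a\<in>K. \<Sum>c\<in>K. h a * h c) = (\<Sum>a\<in>K. h a)\<^sup>2"
    by (simp add: power2_eq_square sum_product)
  finally show ?thesis
    by (simp add: algebra_simps flip: sum_distrib_left)
qed

text \<open>Passes from parametrising triples to the minimal vectors they represent, each counted
  \<open>k\<close> times.\<close>

lemma sum_constant_fibers:
  fixes F :: "'b \<Rightarrow> real"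
  assumes "finite T" and "\<And>x. x \<in> f ` T \<Longrightarrow> card {t \<in> T. f t = x} = k"
  shows "(\<Sum>t\<in>T. F (f t)) = real k * (\<Sum>x\<in>f ` T. F x)"
proof -
  have "(\<Sum>t\<in>T. F (f t)) = (\<Sum>x\<in>f ` T. \<Sum>t\<in>{t \<in> T. f t = x}. F (f t))"
    using assms(1) by (rule sum.image_gen)
  also have "\<dots> = (\<Sum>x\<in>f ` T. real (card {t \<in> T. f t = x}) * F x)"
    by (intro sum.cong refl) simp
  finally show ?thesis
    using assms(2) by (simp add: sum_distrib_left)
qed

section \<open>The group lattice: kernel description, minimal norm and span\<close>

locale odd_abelian_group = comm_group G for G :: "('a, 'b) monoid_scheme" (structure) +
  fixes g :: "'n::finite \<Rightarrow> 'a" and i0 :: 'n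
  assumes odd_card: "odd (card (carrier G))"
    and bij_g: "bij_betw g UNIV (carrier G)" and g_i0: "g i0 = \<one>"
begin

abbreviation \<Lambda> :: "(real ^ 'n) set" where "\<Lambda> \<equiv> group_lattice G g i0"

lemma g_closed [simp]: "g i \<in> carrier G"
  using bij_g by (auto simp: bij_betw_def)

lemma g_eq_iff [simp]: "g i = g j \<longleftrightarrow> i = j"
  using bij_g by (auto simp: bij_betw_def inj_on_def)

lemma eq_if_mult_inv_eq_one:
  "x \<in> carrier G \<Longrightarrow> y \<in> carrier G \<Longrightarrow> x \<otimes> inv y = \<one> \<Longrightarrow> x = y"
  using inv_equality[of x "inv y"] by simp

definition ix :: "'a \<Rightarrow> 'n" where "ix = inv_into UNIV g"

lemma g_ix [simp]: "x \<in> carrier G \<Longrightarrow> g (ix x) = x"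
  using bij_g by (simp add: ix_def bij_betw_def f_inv_into_f)

lemma finite_carrier: "finite (carrier G)"
  using bij_g by (metis bij_betw_finite finite)

lemma card_UNIV_eq: "CARD('n) = card (carrier G)"
  using bij_g by (rule bij_betw_same_card)

text \<open>The product runs over all indices, including \<open>i0\<close>, whose factor is a power
  of the neutral element. So \<open>\<Phi>\<close> is a homomorphism from integer vectors to
  \<open>G\<close>, and the lattice consists of the zero-sum vectors in its kernel.\<close>

definition \<Phi> :: "('n \<Rightarrow> int) \<Rightarrow> 'a" where "\<Phi> z = (\<Otimes>j\<in>UNIV. g j [^] z j)"

lemma \<Phi>_closed [simp]: "\<Phi> z \<in> carrier G"
  by (auto simp: \<Phi>_def intro!: finprod_closed)

lemma \<Phi>_add: "\<Phi> (\<lambda>i. z i + w i) = \<Phi> z \<otimes> \<Phi> w"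
  unfolding \<Phi>_def by (subst finprod_multf[symmetric]) (auto simp: int_pow_mult)

lemma \<Phi>_zero: "\<Phi> (\<lambda>_. 0) = \<one>"
  by (simp add: \<Phi>_def finprod_one_eqI)

lemma \<Phi>_diff: "\<Phi> (\<lambda>i. z i - w i) = \<Phi> z \<otimes> inv (\<Phi> w)"
proof -
  have "\<Phi> z = \<Phi> (\<lambda>i. z i - w i) \<otimes> \<Phi> w"
    using \<Phi>_add[of "\<lambda>i. z i - w i" w] by simp
  then show ?thesis
    by (simp add: m_assoc)
qed

lemma \<Phi>_single: "\<Phi> (\<lambda>i. of_bool (i = a) * k) = g a [^] k"
proof -
  have "\<Phi> (\<lambda>i. of_bool (i = a) * k) = (\<Otimes>j\<in>UNIV. if a = j then g j [^] k else \<one>)"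
    unfolding \<Phi>_def by (intro finprod_cong) (auto simp: simp_implies_def)
  also have "\<dots> = g a [^] k"
    by (rule finprod_singleton) auto
  finally show ?thesis .
qed

lemma \<Phi>_delta: "\<Phi> (\<lambda>i. of_bool (i = a)) = g a"
  using \<Phi>_single[of a 1] by (simp add: int_pow_1)

lemma lattice_eq: "\<Lambda> = {\<chi> i. real_of_int (z i) | z. (\<Sum>i\<in>UNIV. z i) = 0 \<and> \<Phi> z = \<one>}"
proof -
  have "(\<Otimes>j\<in>UNIV - {i0}. g j [^] z j) = \<Phi> z" for z :: "'n \<Rightarrow> int"
    unfolding \<Phi>_def by (rule finprod_mono_neutral_cong_left) (auto simp: g_i0 int_pow_one)
  then show ?thesis
    by (simp add: group_lattice_def)
qed

lemma latticeI: "(\<Sum>i\<in>UNIV. z i) = 0 \<Longrightarrow> \<Phi> z = \<one> \<Longrightarrow> (\<chi> i. real_of_int (z i)) \<in> \<Lambda>"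
  unfolding lattice_eq by blast

lemma latticeE:
  assumes "x \<in> \<Lambda>"
  obtains z where "x = (\<chi> i. real_of_int (z i))" "(\<Sum>i\<in>UNIV. z i) = 0" "\<Phi> z = \<one>"
  using assms unfolding lattice_eq by blast

lemma lattice_zero: "0 \<in> \<Lambda>"
  using latticeI[of "\<lambda>_. 0"] by (simp add: \<Phi>_zero zero_vec_def)

lemma lattice_diff: "x \<in> \<Lambda> \<Longrightarrow> y \<in> \<Lambda> \<Longrightarrow> x - y \<in> \<Lambda>"
proof (elim latticeE)
  fix z w
  assume *: "x = (\<chi> i. real_of_int (z i))" "(\<Sum>i\<in>UNIV. z i) = 0" "\<Phi> z = \<one>"
    "y = (\<chi> i. real_of_int (w i))" "(\<Sum>i\<in>UNIV. w i) = 0" "\<Phi> w = \<one>"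
  have "x - y = (\<chi> i. real_of_int (z i - w i))"
    by (simp add: * vec_eq_iff)
  then show "x - y \<in> \<Lambda>"
    using * latticeI[of "\<lambda>i. z i - w i"] by (simp add: sum_subtractf \<Phi>_diff)
qed

lemma norm_sq_int: "(norm (\<chi> i. real_of_int (z i) :: real ^ 'n))\<^sup>2 = real_of_int (\<Sum>i\<in>UNIV. (z i)\<^sup>2)"
  unfolding power2_norm_eq_inner inner_vec_def by (simp add: power2_eq_square)

text \<open>A vector \<open>e_a - e_b\<close> in the kernel of \<open>\<Phi>\<close> would give
  \<open>g a = g b\<close>, against injectivity. Thus only the four-entry shape survives at squared
  norm at most 4, and there the kernel condition equates the two products.\<close>

lemma lattice_norm_ge: 
  assumes "x \<in> \<Lambda>" "x \<noteq> 0"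
  shows "norm x \<ge> 2"
    and "norm x = 2 \<Longrightarrow> \<exists>a b c d. distinct [a, b, c, d] \<and> g a \<otimes> g b = g c \<otimes> g d \<and>
       x = axis a 1 + axis b 1 - axis c 1 - axis d 1"
proof -
  obtain z where x: "x = (\<chi> i. real_of_int (z i))" and z: "(\<Sum>i\<in>UNIV. z i) = 0" "\<Phi> z = \<one>"
    using assms(1) by (rule latticeE)
  have nz: "z \<noteq> (\<lambda>_. 0)"
    using assms(2) x by (auto simp: zero_vec_def)
  define S where "S = (\<Sum>i\<in>UNIV. (z i)\<^sup>2)"
  have S: "(norm x)\<^sup>2 = real_of_int S"
    by (simp only: x S_def norm_sq_int)
  have *: "S = 4 \<and> (\<exists>a b c d. distinct [a, b, c, d] \<and> g a \<otimes> g b = g c \<otimes> g d \<and>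
       x = axis a 1 + axis b 1 - axis c 1 - axis d 1)" if "S \<le> 4"
  proof (rule small_sum_zero_vector_cases[OF z(1) that[unfolded S_def] nz])
    fix a b assume "a \<noteq> b" and eq: "z = (\<lambda>i. of_bool (i = a) - of_bool (i = b))"
    have "g a \<otimes> inv g b = \<one>"
      using z(2) by (simp only: eq \<Phi>_diff \<Phi>_delta)
    then have "g a = g b"
      by (rule eq_if_mult_inv_eq_one[rotated 2]) simp_all
    with \<open>a \<noteq> b\<close> show ?thesis by simp
  next
    fix a b c d assume d: "distinct [a, b, c, d]"
      and eq: "z = (\<lambda>i. of_bool (i = a) + of_bool (i = b) - of_bool (i = c) - of_bool (i = d))"
    have "\<Phi> z = g a \<otimes> g b \<otimes> inv g c \<otimes> inv g d"
      by (simp only: eq \<Phi>_diff \<Phi>_add \<Phi>_delta)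
    then have "g a \<otimes> g b \<otimes> inv (g c \<otimes> g d) = \<one>"
      using z(2) by (simp add: inv_mult m_assoc)
    then have "g a \<otimes> g b = g c \<otimes> g d"
      by (rule eq_if_mult_inv_eq_one[rotated 2]) simp_all
    moreover have "x = axis a 1 + axis b 1 - axis c 1 - axis d 1"
      by (simp add: x eq vec_eq_iff axis_def)
    moreover have "(z i)\<^sup>2 = of_bool (i = a) + of_bool (i = b) + of_bool (i = c) + of_bool (i = d)" for i
      using d by (auto simp: eq)
    then have "S = 4"
      by (simp add: S_def sum.distrib)
    ultimately show ?thesis using d by blast
  qed
  then have "S \<ge> 4" by linarith
  then have "(norm x)\<^sup>2 \<ge> 2\<^sup>2"
    using S by simp
  then show "norm x \<ge> 2"
    by (rule power2_le_imp_le) simp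
  show "\<exists>a b c d. distinct [a, b, c, d] \<and> g a \<otimes> g b = g c \<otimes> g d \<and>
       x = axis a 1 + axis b 1 - axis c 1 - axis d 1" if "norm x = 2"
    using * S that by simp
qed

text \<open>Discreteness is uniform: distinct lattice points are at distance at least 2.\<close>

lemma euclidean_lattice: "euclidean_lattice \<Lambda>"
proof -
  have "x isolated_in \<Lambda>" if x: "x \<in> \<Lambda>" for x
    unfolding isolated_in_dist_Ex_iff
  proof (intro conjI exI[of _ 2] ballI impI)
    fix y assume "y \<in> \<Lambda>" "dist x y < 2"
    then show "y = x"
      using lattice_norm_ge(1)[OF lattice_diff[OF x \<open>y \<in> \<Lambda>\<close>]] by (force simp: dist_norm)
  qed (use x in auto)
  then show ?thesis
    using lattice_zero lattice_diff by (simp add: euclidean_lattice_def discrete_def)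
qed

text \<open>With \<open>n\<close> the group order, \<open>n (e_a - e_i0)\<close> lies in the lattice
  since \<open>g a\<close> to the power \<open>n\<close> is neutral, and these vectors span the
  whole zero-sum hyperplane.\<close>

lemma span_lattice: "span \<Lambda> = {y. (\<Sum>i\<in>UNIV. y $ i) = 0}" (is "_ = ?V")
proof
  have "subspace ?V"
    by (auto simp: subspace_def sum.distrib simp flip: sum_distrib_left)
  moreover have "\<Lambda> \<subseteq> ?V"
    by (auto elim!: latticeE simp flip: of_int_sum)
  ultimately show "span \<Lambda> \<subseteq> ?V"
    by (rule span_minimal[rotated])
  show "?V \<subseteq> span \<Lambda>"
  proof
    fix y :: "real ^ 'n" assume y: "y \<in> ?V"
    define n where "n = card (carrier G)"
    have n: "n > 0"
      using finite_carrier by (auto simp: n_def card_gt_0_iff)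
    have gen: "axis a 1 - axis i0 1 \<in> span \<Lambda>" for a
    proof -
      let ?z = "\<lambda>i. of_bool (i = a) * int n - of_bool (i = i0) * int n"
      have "\<Phi> ?z = g a [^] int n \<otimes> inv (g i0 [^] int n)"
        by (simp only: \<Phi>_diff \<Phi>_single)
      also have "\<dots> = \<one>"
        using pow_order_eq_1[of "g a"] by (simp add: g_i0 int_pow_int n_def order_def int_pow_one)
      finally have "(\<chi> i. real_of_int (?z i)) \<in> \<Lambda>"
        by (intro latticeI) (simp_all add: sum_subtractf)
      then have "(1 / real n) *\<^sub>R (\<chi> i. real_of_int (?z i)) \<in> span \<Lambda>"
        by (intro span_scale span_base)
      also have "(1 / real n) *\<^sub>R (\<chi> i. real_of_int (?z i)) = axis a 1 - axis i0 1"
        using n by (simp add: vec_eq_iff axis_def)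
      finally show ?thesis .
    qed
    \<comment> \<open>The subtracted term is zero; it turns the standard expansion into a
      combination of the vectors \<open>e_a - e_i0\<close>.\<close>
    have "y = (\<Sum>a\<in>UNIV. y $ a *\<^sub>R axis a 1) - (\<Sum>a\<in>UNIV. y $ a) *\<^sub>R axis i0 1"
      using basis_expansion[of y] y by (simp add: scalar_mult_eq_scaleR)
    also have "\<dots> = (\<Sum>a\<in>UNIV. y $ a *\<^sub>R (axis a 1 - axis i0 1))"
      by (simp only: scaleR_diff_right sum_subtractf scaleR_sum_left)
    also have "\<dots> \<in> span \<Lambda>"
      by (intro span_sum span_scale gen)
    finally show "y \<in> span \<Lambda>" .
  qed
qed

section \<open>The involution attached to a group element, and squaring\<close>

text \<open>The index version of \<open>x \<mapsto> s - x\<close>. The group element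
  \<open>s\<close> is itself given by its index, so that sums over \<open>s\<close> and over
  coordinates run over the same type.\<close>

definition partner :: "'n \<Rightarrow> 'n \<Rightarrow> 'n" where "partner s a = ix (g s \<otimes> inv g a)"

lemma partner_eq_iff: "partner s a = b \<longleftrightarrow> g a \<otimes> g b = g s"
proof -
  have "partner s a = b \<longleftrightarrow> g s \<otimes> inv g a = g b"
    by (metis partner_def g_ix g_eq_iff g_closed inv_closed m_closed)
  also have "\<dots> \<longleftrightarrow> g a \<otimes> g b = g s"
    by (metis g_closed inv_closed inv_solve_right' m_closed m_comm)
  finally show ?thesis .
qed

lemma g_mult_partner: "g a \<otimes> g (partner s a) = g s"
  using partner_eq_iff by blast

lemma partner_partner [simp]: "partner s (partner s a) = a"
  by (metis partner_eq_iff m_comm g_closed)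

lemma bij_partner: "bij (partner s)"
  by (rule involuntory_imp_bij) simp

text \<open>With \<open>a\<close> fixed and \<open>s\<close> varying, the partner runs through all
  indices once. This is what makes the mixed terms of the eutaxy sum vanish.\<close>

lemma bij_partner_left: "bij (\<lambda>s. partner s a)"
proof -
  have "inj (\<lambda>s. partner s a)"
    by (rule injI) (metis g_mult_partner g_eq_iff)
  then show ?thesis
    using finite_UNIV_inj_surj[of "\<lambda>s. partner s a"] by (simp add: bij_def)
qed

definition sq :: "'n \<Rightarrow> 'n" where "sq a = ix (g a \<otimes> g a)"

lemma partner_fixed_iff: "partner s a = a \<longleftrightarrow> s = sq a"
  by (metis partner_eq_iff sq_def g_ix g_eq_iff g_closed m_closed)

text \<open>The order is \<open>2k + 1\<close>, and \<open>x\<close> to that power is neutral; but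
  it also equals \<open>x\<close> when the square of \<open>x\<close> is neutral.\<close>

lemma square_eq_one: 
  assumes x: "x \<in> carrier G" "x \<otimes> x = \<one>" shows "x = \<one>"
proof -
  obtain k where k: "order G = 2 * k + 1"
    using odd_card by (auto simp: order_def elim: oddE)
  have "\<one> = x [^] (2 * k + 1)"
    using pow_order_eq_1[OF x(1)] k by simp
  also have "\<dots> = (x [^] (2::nat)) [^] k \<otimes> x"
    using x(1) by (simp add: nat_pow_pow)
  also have "\<dots> = x"
    using x by (simp add: numeral_2_eq_2 nat_pow_one)
  finally show ?thesis ..
qed

text \<open>Squaring is an endomorphism of a commutative group, with trivial kernel by
  \<open>square_eq_one\<close>. Hence each \<open>s\<close> has exactly one self-paired index, and
  distinct \<open>s\<close> have distinct ones.\<close>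

lemma bij_sq: "bij sq"
proof -
  have "inj sq"
  proof (rule injI)
    fix a b assume "sq a = sq b"
    then have eq: "g a \<otimes> g a = g b \<otimes> g b"
      by (metis sq_def g_ix g_closed m_closed)
    have "(g a \<otimes> inv g b) \<otimes> (g a \<otimes> inv g b) = (g a \<otimes> g a) \<otimes> inv (g b \<otimes> g b)"
    proof -
      have "(x \<otimes> y) \<otimes> (x \<otimes> y) = (x \<otimes> x) \<otimes> (y \<otimes> y)" if "x \<in> carrier G" "y \<in> carrier G" for x y
      proof -
        have "(x \<otimes> y) \<otimes> (x \<otimes> y) = x \<otimes> (y \<otimes> (x \<otimes> y))"
          using that by (intro m_assoc) auto
        also have "y \<otimes> (x \<otimes> y) = x \<otimes> (y \<otimes> y)"
          using that by (intro m_lcomm) auto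
        also have "x \<otimes> (x \<otimes> (y \<otimes> y)) = (x \<otimes> x) \<otimes> (y \<otimes> y)"
          using that by (intro m_assoc[symmetric]) auto
        finally show ?thesis .
      qed
      from this[of "g a" "inv g b"] show ?thesis
        by (simp add: inv_mult)
    qed
    also have "\<dots> = \<one>"
      unfolding eq by (intro r_inv) simp
    finally have "g a \<otimes> inv g b = \<one>"
      by (rule square_eq_one[rotated]) simp
    then have "g a = g b"
      by (rule eq_if_mult_inv_eq_one[rotated 2]) simp_all
    then show "a = b" by simp
  qed
  then show ?thesis
    using finite_UNIV_inj_surj[of sq] by (simp add: bij_def)
qed

text \<open>Each minimal vector arises as \<open>v (s, a, c)\<close> from exactly four triples, since \<open>a\<close> and \<open>c\<close>
  may be replaced by their partners.\<close>

definition T :: "('n \<times> 'n \<times> 'n) set" where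
  "T = {(s, a, c). partner s a \<noteq> a \<and> partner s c \<noteq> c \<and> c \<noteq> a \<and> c \<noteq> partner s a}"

definition v :: "'n \<times> 'n \<times> 'n \<Rightarrow> real ^ 'n" where
  "v = (\<lambda>(s, a, c). axis a 1 + axis (partner s a) 1 - axis c 1 - axis (partner s c) 1)"

lemma T_distinct: "(s, a, c) \<in> T \<longleftrightarrow> distinct [a, partner s a, c, partner s c]"
  by (auto simp: T_def) (metis partner_partner)+

lemma v_lattice: "v t \<in> \<Lambda>"
proof -
  obtain s a c where t: "t = (s, a, c)" by (cases t)
  let ?z = "\<lambda>i. of_bool (i = a) + of_bool (i = partner s a) - of_bool (i = c) - of_bool (i = partner s c) :: int"
  have "\<Phi> ?z = g a \<otimes> g (partner s a) \<otimes> inv g c \<otimes> inv g (partner s c)"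
    by (simp only: \<Phi>_diff \<Phi>_add \<Phi>_delta)
  also have "\<dots> = g a \<otimes> g (partner s a) \<otimes> inv (g c \<otimes> g (partner s c))"
    by (simp add: inv_mult m_assoc)
  also have "\<dots> = \<one>"
    by (simp add: g_mult_partner)
  finally have "(\<chi> i. real_of_int (?z i)) \<in> \<Lambda>"
    by (intro latticeI) (simp_all add: sum_subtractf sum.distrib)
  also have "(\<chi> i. real_of_int (?z i)) = v t"
    by (simp add: t v_def vec_eq_iff axis_def)
  finally show ?thesis .
qed

lemma v_inner: "v (s, a, c) \<bullet> y = y $ a + y $ partner s a - y $ c - y $ partner s c"
  by (simp add: v_def inner_diff_left inner_add_left inner_axis')

lemma norm_v: "t \<in> T \<Longrightarrow> norm (v t) = 2"
proof -
  assume T: "t \<in> T"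
  obtain s a c where t: "t = (s, a, c)" by (cases t)
  have "v t \<bullet> v t = 4"
    using T unfolding t T_distinct v_inner by (auto simp: v_def axis_def)
  then show ?thesis
    by (simp add: norm_eq_sqrt_inner)
qed

lemma v_nth_eq_1_iff: "(s, a, c) \<in> T \<Longrightarrow> v (s, a, c) $ i = 1 \<longleftrightarrow> i \<in> {a, partner s a}"
  and v_nth_eq_minus_1_iff: "(s, a, c) \<in> T \<Longrightarrow> v (s, a, c) $ i = -1 \<longleftrightarrow> i \<in> {c, partner s c}"
  unfolding T_distinct by (auto simp: v_def axis_def)

text \<open>The entries 1 and -1 of the vector recover the unordered pairs of \<open>a\<close> and
  of \<open>c\<close>, and the product over the first pair recovers \<open>s\<close>. Only the
  choice within each pair stays free.\<close>

lemma v_fiber: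
  assumes "(s, a, c) \<in> T"
  shows "{t \<in> T. v t = v (s, a, c)} = {s} \<times> {a, partner s a} \<times> {c, partner s c}"
proof (intro Set.set_eqI iffI)
  fix t assume *: "t \<in> {t \<in> T. v t = v (s, a, c)}"
  obtain s' a' c' where t: "t = (s', a', c')" by (cases t)
  have T: "(s', a', c') \<in> T" and eq: "v (s', a', c') = v (s, a, c)"
    using * t by auto
  have a: "{a', partner s' a'} = {a, partner s a}"
    using v_nth_eq_1_iff[OF T] v_nth_eq_1_iff[OF assms] eq by auto
  have c: "{c', partner s' c'} = {c, partner s c}"
    using v_nth_eq_minus_1_iff[OF T] v_nth_eq_minus_1_iff[OF assms] eq by auto
  have "s' = s"
  proof -
    have "a' = a \<and> partner s' a' = partner s a \<or> a' = partner s a \<and> partner s' a' = a"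
      using a by (simp only: doubleton_eq_iff)
    then have "g a' \<otimes> g (partner s' a') = g a \<otimes> g (partner s a)"
      by (auto simp: m_comm)
    then show ?thesis
      by (simp only: g_mult_partner g_eq_iff)
  qed
  then show "t \<in> {s} \<times> {a, partner s a} \<times> {c, partner s c}"
    using a c t by blast
next
  fix t assume "t \<in> {s} \<times> {a, partner s a} \<times> {c, partner s c}"
  then obtain a' c' where t: "t = (s, a', c')" "a' \<in> {a, partner s a}" "c' \<in> {c, partner s c}"
    by auto
  then have "v t = v (s, a, c)"
    by (auto simp: v_def)
  moreover have "t \<in> T"
    using t assms unfolding t(1) T_distinct by auto
  ultimately show "t \<in> {t \<in> T. v t = v (s, a, c)}" by simp
qed

lemma card_v_fiber: "x \<in> v ` T \<Longrightarrow> card {t \<in> T. v t = x} = 4"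
proof -
  assume "x \<in> v ` T"
  then obtain s a c where T: "(s, a, c) \<in> T" and x: "x = v (s, a, c)"
    by auto
  then show ?thesis
    using T by (simp add: x v_fiber[OF T] T_distinct card_cartesian_product)
qed

section \<open>The eutaxy sum over triples\<close>

text \<open>With \<open>n = CARD('n)\<close>: \<open>n - 1\<close> is the number of non-fixed
  indices for each \<open>s\<close>, \<open>2n - 4\<close> comes from the second moment of
  \<open>h\<close> summed over \<open>s\<close>, and \<open>-8\<close> from the squared first
  moment. It counts every minimal vector four times.\<close>

definition energy :: real where
  "energy = 2 * real (CARD('n) - 1) * (2 * real CARD('n) - 4) - 8"

lemma sum_T:
  assumes y: "(\<Sum>i\<in>UNIV. y $ i) = 0"
  shows "(\<Sum>t\<in>T. (v t \<bullet> y)\<^sup>2) = energy * (y \<bullet> y)"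
proof -
  define K where "K s = {a. partner s a \<noteq> a}" for s
  define m where "m = inv_into UNIV sq"
  define h where "h s a = y $ a + y $ partner s a" for s a
  define Y where "Y = (\<Sum>a\<in>UNIV. (y $ a)\<^sup>2)"
  define p where "p s = (\<Sum>a\<in>UNIV. y $ a * y $ partner s a)" for s
  have m: "s = sq a \<longleftrightarrow> a = m s" for s a
    using bij_sq unfolding m_def by (metis bij_inv_eq_iff)
  have bij_m: "bij m"
    unfolding m_def by (rule bij_imp_bij_inv[OF bij_sq])
  have K: "K s = UNIV - {m s}" for s
    by (auto simp: K_def partner_fixed_iff m)
  have hm: "h s (m s) = 2 * y $ m s" for s
    using partner_fixed_iff[of s "m s"] m by (simp add: h_def)
  have reindex: "(\<Sum>a\<in>UNIV. f (partner s a)) = (\<Sum>a\<in>UNIV. f a)" for f :: "'n \<Rightarrow> real" and s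
    using bij_partner by (rule sum.reindex_bij_betw)
  have h1: "(\<Sum>a\<in>K s. h s a) = - 2 * y $ m s" for s
  proof -
    have "(\<Sum>a\<in>UNIV. h s a) = 0"
      unfolding h_def sum.distrib using reindex[of "\<lambda>a. y $ a"] y by simp
    then show ?thesis
      by (simp add: K sum_diff1 hm)
  qed
  have h2: "(\<Sum>a\<in>K s. (h s a)\<^sup>2) = 2 * Y + 2 * p s - 4 * (y $ m s)\<^sup>2" for s
  proof -
    have "(\<Sum>a\<in>UNIV. (h s a)\<^sup>2) = Y + (\<Sum>a\<in>UNIV. (y $ partner s a)\<^sup>2) + 2 * p s"
      unfolding h_def power2_sum sum.distrib Y_def p_def by (simp add: sum_distrib_left mult.assoc)
    also have "(\<Sum>a\<in>UNIV. (y $ partner s a)\<^sup>2) = Y"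
      unfolding Y_def by (rule reindex)
    finally show ?thesis
      by (simp add: K sum_diff1 hm power_mult_distrib)
  qed
  \<comment> \<open>After exchanging the sums, the inner one is the full coordinate sum of
    \<open>y\<close>, which is zero.\<close>
  have p: "(\<Sum>s\<in>UNIV. p s) = 0"
  proof -
    have "(\<Sum>s\<in>UNIV. p s) = (\<Sum>a\<in>UNIV. y $ a * (\<Sum>s\<in>UNIV. y $ partner s a))"
      unfolding p_def sum_distrib_left by (rule sum.swap)
    moreover have "(\<Sum>s\<in>UNIV. y $ partner s a) = 0" for a
      using sum.reindex_bij_betw[OF bij_partner_left, of "\<lambda>i. y $ i" a] y by simp
    ultimately show ?thesis by simp
  qed
  have Ym: "(\<Sum>s\<in>UNIV. (y $ m s)\<^sup>2) = Y"
    unfolding Y_def using bij_m by (rule sum.reindex_bij_betw)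
  \<comment> \<open>Pairs in \<open>K s \<times> K s\<close> outside \<open>T\<close> have
    \<open>c = a\<close> or \<open>c = partner s a\<close>. There \<open>v t\<close> is orthogonal
    to every \<open>y\<close>, so the sum may be extended to a full square.\<close>
  have "(\<Sum>t\<in>T. (v t \<bullet> y)\<^sup>2) = (\<Sum>t\<in>(SIGMA s:UNIV. K s \<times> K s). (v t \<bullet> y)\<^sup>2)"
    by (rule sum.mono_neutral_left) (auto simp: T_def K_def v_inner)
  also have "\<dots> = (\<Sum>s\<in>UNIV. \<Sum>a\<in>K s. \<Sum>c\<in>K s. (h s a - h s c)\<^sup>2)"
  proof -
    have "v t \<bullet> y = h (fst t) (fst (snd t)) - h (fst t) (snd (snd t))" for t
      by (cases t) (simp add: v_inner h_def)
    then show ?thesis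
      by (simp add: sum.Sigma sum.cartesian_product split_def)
  qed
  also have "\<dots> = (\<Sum>s\<in>UNIV. 2 * real (CARD('n) - 1) * (2 * Y + 2 * p s - 4 * (y $ m s)\<^sup>2) - 8 * (y $ m s)\<^sup>2)"
    unfolding sum_sum_diff_squares h1 h2 by (simp add: K power2_eq_square)
  also have "\<dots> = 2 * real (CARD('n) - 1) * (2 * real CARD('n) * Y + 2 * (\<Sum>s\<in>UNIV. p s)
      - 4 * (\<Sum>s\<in>UNIV. (y $ m s)\<^sup>2)) - 8 * (\<Sum>s\<in>UNIV. (y $ m s)\<^sup>2)"
    by (simp add: sum_subtractf sum.distrib flip: sum_distrib_left)
  also have "\<dots> = energy * Y"
    unfolding p Ym energy_def by (simp add: algebra_simps)
  also have "Y = y \<bullet> y"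
    by (simp add: Y_def inner_vec_def power2_eq_square)
  finally show ?thesis .
qed

section \<open>Identification of the minimal vectors\<close>

text \<open>For \<open>s = i0\<close> the partner map is inversion, whose only fixed point is
  \<open>i0\<close>; it remains to pick \<open>a\<close> and then \<open>c\<close> outside a short
  list of indices.\<close>

lemma T_nonempty:
  assumes "CARD('n) \<ge> 5"
  shows "T \<noteq> {}"
proof -
  have small: "\<exists>a. a \<notin> set xs" if "length xs \<le> 4" for xs :: "'n list"
  proof (rule ccontr)
    assume "\<nexists>a. a \<notin> set xs"
    then have "set xs = UNIV" by auto
    then show False
      using card_length[of xs] that assms by simp
  qed
  define s where "s = i0"
  obtain a where "a \<notin> set [i0]"
    using small[of "[i0]"] by auto
  then have a: "a \<noteq> i0" by simp
  obtain c where c: "c \<notin> set [i0, a, partner s a]"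
    using small[of "[i0, a, partner s a]"] by auto
  have "sq i0 = i0"
    by (metis partner_fixed_iff partner_eq_iff g_i0 one_closed r_one)
  then have "partner s b \<noteq> b" if "b \<noteq> i0" for b
    using bij_sq that s_def by (metis partner_fixed_iff bij_def injD)
  then have "(s, a, c) \<in> T"
    using a c by (simp add: T_def)
  then show ?thesis by blast
qed

lemma min_vectors_lattice:
  assumes "CARD('n) \<ge> 5"
  shows "min_norm \<Lambda> = 2" and "min_vectors \<Lambda> = v ` T"
proof -
  obtain t where t: "t \<in> T"
    using T_nonempty[OF assms] by blast
  show min: "min_norm \<Lambda> = 2"
    unfolding min_norm_def
  proof (rule cInf_eq_minimum)
    have "norm (v t) \<in> norm ` (\<Lambda> - {0})"
      using v_lattice[of t] norm_v[OF t] by (intro imageI) auto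
    then show "2 \<in> norm ` (\<Lambda> - {0})"
      using norm_v[OF t] by simp
  qed (use lattice_norm_ge(1) in auto)
  show "min_vectors \<Lambda> = v ` T"
  proof (intro Set.set_eqI iffI)
    fix x assume "x \<in> min_vectors \<Lambda>"
    then have x: "x \<in> \<Lambda>" "norm x = 2"
      by (auto simp: min_vectors_def min)
    then obtain a b c d where d: "distinct [a, b, c, d]" and eq: "g a \<otimes> g b = g c \<otimes> g d"
      and x: "x = axis a 1 + axis b 1 - axis c 1 - axis d 1"
      using lattice_norm_ge(2)[of x] by force
    define s where "s = ix (g a \<otimes> g b)"
    have "g s = g a \<otimes> g b"
      by (simp add: s_def)
    then have "partner s a = b" "partner s c = d"
      using eq by (auto simp: partner_eq_iff)
    then have "x = v (s, a, c)" "(s, a, c) \<in> T"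
      using d x by (auto simp: v_def T_distinct)
    then show "x \<in> v ` T" by blast
  qed (use v_lattice norm_v in \<open>auto simp: min_vectors_def min\<close>)
qed

text \<open>Exchanging \<open>a\<close> and \<open>c\<close> negates the vector, so the set is
  antipodal.\<close>

lemma sum_v: "(\<Sum>x\<in>v ` T. x) = 0"
proof -
  have "uminus ` v ` T = v ` T"
  proof -
    have "- v t \<in> v ` T" if "t \<in> T" for t
    proof -
      obtain s a c where t: "t = (s, a, c)" by (cases t)
      have "(s, c, a) \<in> T"
        using that by (auto simp: t T_distinct)
      moreover have "- v t = v (s, c, a)"
        by (simp add: t v_def)
      ultimately show ?thesis by blast
    qed
    then have "uminus ` v ` T \<subseteq> v ` T" by blast
    moreover from this have "uminus ` uminus ` v ` T \<subseteq> uminus ` v ` T"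
      by (rule image_mono)
    ultimately show ?thesis
      by (simp add: image_image)
  qed
  then have "(\<Sum>x\<in>v ` T. x) = (\<Sum>x\<in>uminus ` v ` T. x)"
    by simp
  also have "\<dots> = - (\<Sum>x\<in>v ` T. x)"
    by (subst sum.reindex) (auto simp: sum_negf)
  finally have "2 *\<^sub>R (\<Sum>x\<in>v ` T. x) = 0"
    unfolding scaleR_2 by (metis add.right_inverse)
  then show ?thesis by simp
qed

end

theorem theorem2p4:
  fixes G :: "('a, 'b) monoid_scheme" and g :: "'n::finite \<Rightarrow> 'a" and i0 :: 'n
  assumes "comm_group G" and "finite (carrier G)"
    and "odd (card (carrier G))" and "card (carrier G) \<ge> 5"
    and "bij_betw g UNIV (carrier G)" and "g i0 = \<one>\<^bsub>G\<^esub>"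
  shows "strongly_eutactic (group_lattice G g i0)"
proof -
  interpret comm_group G by fact
  interpret odd_abelian_group G g i0
    by unfold_locales (use assms in auto)
  have "CARD('n) \<ge> 5"
    using assms(4) card_UNIV_eq by simp
  note min = min_vectors_lattice[OF this] and nonempty = T_nonempty[OF this]
  let ?X = "(\<lambda>x. x /\<^sub>R 2) ` v ` T"
  have finT: "finite T" by simp
  have sum_X: "(\<Sum>x\<in>?X. f x) = (\<Sum>x\<in>v ` T. f (x /\<^sub>R 2))" for f :: "real ^ 'n \<Rightarrow> 'c::comm_monoid_add"
    by (rule sum.reindex_cong[OF _ refl refl]) (auto simp: inj_on_def)
  have "spherical_design 2 (span \<Lambda>) ?X"
  proof (rule spherical_2_design_criterion)
    show "subspace (span \<Lambda>)" by simp
    show "?X \<subseteq> span \<Lambda> \<inter> sphere 0 1"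
      using norm_v by (auto intro!: span_scale intro: span_base v_lattice)
    have "\<Sum>?X = (\<Sum>x\<in>v ` T. x /\<^sub>R 2)"
      by (rule sum_X)
    also have "\<dots> = 0"
      using sum_v by (simp flip: scaleR_sum_right)
    finally show "\<Sum>?X = 0" .
    fix y assume "y \<in> span \<Lambda>"
    then have y: "(\<Sum>i\<in>UNIV. y $ i) = 0"
      by (simp add: span_lattice)
    have "(\<Sum>x\<in>?X. (x \<bullet> y)\<^sup>2) = (\<Sum>x\<in>v ` T. (x \<bullet> y)\<^sup>2) / 4"
      unfolding sum_X sum_divide_distrib by (intro sum.cong refl) (simp add: power2_eq_square)
    moreover have "energy * (y \<bullet> y) = real 4 * (\<Sum>x\<in>v ` T. (x \<bullet> y)\<^sup>2)"
      using sum_constant_fibers[OF finT card_v_fiber, of "\<lambda>x. (x \<bullet> y)\<^sup>2"] sum_T[OF y] by simp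
    \<comment> \<open>One factor 4 in 16 comes from halving the vectors to norm 1, the other from
      the four triples per minimal vector.\<close>
    ultimately show "(\<Sum>x\<in>?X. (x \<bullet> y)\<^sup>2) = (energy / 16) * (y \<bullet> y)"
      by simp
  qed (use nonempty in auto)
  then show ?thesis
    using euclidean_lattice by (simp add: strongly_eutactic_def min)
qed

end
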